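(* Let $T,m,p\in\mathbb N$. For each task $i=1,\dots,T$, let $S_i=\{(u_{i,r},q_{i,r})\}_{r=1}^{n_i}$, with $q_{i,r}\in\{1,\dots,m\}$, be a finite (nonempty) support set. For fixed $x\in X$ and a finite dataset $D$, let $F_{x,D}(u)\in\mathbb R^p$ denote the feature vector produced for $u$ by a shared feature extractor (an arbitrary map depending on $x$ and $D$), and set $F_{i,r}(x):=F_{x,S_i}(u_{i,r})$. Let $(W_i,b_i)\in\mathbb R^{m\times p}\times\mathbb R^m$ be the task-specific linear classifier and $y=((W_i,b_i))_{i=1}^T\in Y$, where $Y\subseteq\prod_{i=1}^T(\mathbb R^{m\times p}\times\mathbb R^m)$ is convex. Define $\ell(s,q):=\log\bigl(\sum_{j=1}^me^{s_j}\bigr)-s_q$ for $s=(s_1,\dots,s_m)\in\mathbb R^m$, and, for all $y=((W_i,b_i))_{i=1}^T\in Y$, $$g(x,y):=\frac1T\sum_{i=1}^T\frac1{n_i}\sum_{r=1}^{n_i}\ell\bigl(W_iF_{i,r}(x)+b_i,\ q_{i,r}\bigr).$$ Then, for every fixed $x\in X$, $g(x,\cdot)$ is convex on $Y$ and satisfies: if $y_0,y_1\in Y$ and $t\mapsto g(x,(1-t)y_0+ty_1)$ is affine on $[0,1]$, then it is constant on $[0,1]$. Consequently (under the standing assumptions of the context), ENNAMCQ holds for every $\delta>0$, i.e. $0\notin\nabla R(w)+N_C(w)$ for every $w\in C$ with $R(w)\ge0$.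
   Context: Standing assumptions for the ENNAMCQ conclusion. $X$ and $Y$ are nonempty compact convex subsets of Euclidean spaces; $C=X\times Y$. The function $g$ is continuously differentiable on a neighborhood of $C$, with $\nabla g$ Lipschitz on $C$. $\sigma\ge0$ is such that $g(x,\cdot)+\frac\sigma2\|\cdot\|^2$ is convex on $Y$ for every $x\in X$; $\rho>0$ satisfies $\rho\sigma<1$. Put $g_\rho(x,y)=\min_{z\in Y}\{g(x,z)+\frac1{2\rho}\|z-y\|^2\}$, with unique minimizer $z_\rho(x,y)$, and $R(x,y)=g(x,y)-g_\rho(x,y)-\delta$. $R$ is continuously differentiable on $C$ with $\nabla R(x,y)=\bigl(\nabla_xg(x,y)-\nabla_xg(x,z_\rho(x,y)),\ \nabla_yg(x,y)-\rho^{-1}(y-z_\rho(x,y))\bigr)$. $N_C$ denotes the normal cone to $C$ in the sense of convex analysis. *)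

theory Defs
  imports "HOL-Analysis.Analysis"
begin

type_synonym ('p, 'm, 't) classifiers = "((real^'p^'m) \<times> (real^'m))^'t"

definition cross_entropy :: "real^'m \<Rightarrow> 'm::finite \<Rightarrow> real" where
  "cross_entropy s q = ln (\<Sum>j\<in>UNIV. exp (s $ j)) - s $ q"

text \<open>A support set is a list of (input, label) pairs, so repetitions are allowed. The extractor
  \<open>F x D u\<close> may depend arbitrarily on the parameter \<open>x\<close>, the dataset \<open>D\<close> and the input \<open>u\<close>.\<close>

definition support_loss ::
  "('a \<Rightarrow> ('u \<times> 'm) list \<Rightarrow> 'u \<Rightarrow> real^'p::finite) \<Rightarrow> ('t::finite \<Rightarrow> ('u \<times> 'm::finite) list)
    \<Rightarrow> 'a \<Rightarrow> ('p, 'm, 't) classifiers \<Rightarrow> real" where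
  "support_loss F S x y =
    1 / real CARD('t) * (\<Sum>i\<in>UNIV. 1 / real (length (S i)) *
      (\<Sum>r<length (S i).
        cross_entropy (fst (y $ i) *v F x (S i) (fst (S i ! r)) + snd (y $ i)) (snd (S i ! r))))"

text \<open>The gradient at a point of differentiability; unspecified elsewhere.\<close>

definition gradient :: "('a::real_inner \<Rightarrow> real) \<Rightarrow> 'a \<Rightarrow> 'a" where
  "gradient f w = (THE v. GDERIV f w :> v)"

lemma gradient_eqI: "GDERIV f w :> v \<Longrightarrow> gradient f w = v"
proof -
  assume v: "GDERIV f w :> v"
  have "v' = v" if "GDERIV f w :> v'" for v'
  proof -
    have "(\<lambda>h. inner h v') = (\<lambda>h. inner h v)"
      using v that unfolding gderiv_def by (rule has_derivative_unique[rotated])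
    then have "inner (v' - v) v' = inner (v' - v) v"
      by (rule fun_cong)
    then have "inner (v' - v) (v' - v) = 0"
      by (simp add: inner_diff_right)
    then show "v' = v"
      by simp
  qed
  with v show ?thesis
    unfolding gradient_def by blast
qed

definition normal_cone :: "'a::real_inner set \<Rightarrow> 'a \<Rightarrow> 'a set" where
  "normal_cone C w = (if w \<in> C then {v. \<forall>c\<in>C. inner v (c - w) \<le> 0} else {})"

text \<open>The infimum is a minimum whenever \<open>Y\<close> is nonempty and compact and \<open>g (x, \<cdot>)\<close> is
  continuous on \<open>Y\<close>.\<close>

definition moreau_env ::
  "'b set \<Rightarrow> real \<Rightarrow> ('a \<times> 'b::real_normed_vector \<Rightarrow> real) \<Rightarrow> 'a \<times> 'b \<Rightarrow> real" where
  "moreau_env Y \<rho> g = (\<lambda>(x, y). INF z\<in>Y. g (x, z) + 1 / (2 * \<rho>) * (norm (z - y))\<^sup>2)"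

definition residual ::
  "'b set \<Rightarrow> real \<Rightarrow> real \<Rightarrow> ('a \<times> 'b::real_normed_vector \<Rightarrow> real) \<Rightarrow> 'a \<times> 'b \<Rightarrow> real" where
  "residual Y \<rho> \<delta> g w = g w - moreau_env Y \<rho> g w - \<delta>"

text \<open>The residual is defined by its formula on the whole space, so its gradient is the ordinary
  one, also at boundary points of \<open>X \<times> Y\<close>. If \<open>g\<close> is continuously differentiable near the compact
  set \<open>X \<times> Y\<close> and the minimizer in the envelope is unique, this gradient exists at every point of
  \<open>X \<times> Y\<close>.\<close>

definition ENNAMCQ ::
  "'a::euclidean_space set \<Rightarrow> 'b::euclidean_space set \<Rightarrow> real \<Rightarrow> real \<Rightarrow> ('a \<times> 'b \<Rightarrow> real) \<Rightarrow> bool"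
  where
  "ENNAMCQ X Y \<rho> \<delta> g \<longleftrightarrow>
    (\<forall>w\<in>X \<times> Y. residual Y \<rho> \<delta> g w \<ge> 0 \<longrightarrow>
      0 \<notin> {gradient (residual Y \<rho> \<delta> g) w + v | v. v \<in> normal_cone (X \<times> Y) w})"

text \<open>Continuous differentiability on some neighbourhood of \<open>C\<close>, with gradient Lipschitz on \<open>C\<close>.\<close>

definition smooth_around :: "'a::real_inner set \<Rightarrow> ('a \<Rightarrow> real) \<Rightarrow> bool" where
  "smooth_around C g \<longleftrightarrow>
    (\<exists>U. open U \<and> C \<subseteq> U \<and> (\<forall>w\<in>U. g differentiable (at w)) \<and> continuous_on U (gradient g)) \<and>
    (\<exists>L. L-lipschitz_on C (gradient g))"

definition standing_assumptions ::
  "'a::euclidean_space set \<Rightarrow> 'b::euclidean_space set \<Rightarrow> ('a \<times> 'b \<Rightarrow> real) \<Rightarrow> real \<Rightarrow> real \<Rightarrow> bool"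
  where
  "standing_assumptions X Y g \<sigma> \<rho> \<longleftrightarrow>
    X \<noteq> {} \<and> compact X \<and> convex X \<and> Y \<noteq> {} \<and> compact Y \<and> convex Y \<and>
    smooth_around (X \<times> Y) g \<and>
    \<sigma> \<ge> 0 \<and> (\<forall>x\<in>X. convex_on Y (\<lambda>y. g (x, y) + \<sigma> / 2 * (norm y)\<^sup>2)) \<and>
    \<rho> > 0 \<and> \<rho> * \<sigma> < 1"

end

theory Submission
  imports Defs
begin

section \<open>Convex functions with rigid segments\<close>

text \<open>Affineness on a segment is used only through its midpoint: convexity gaps at the midpoint are
  nonnegative and add up, so equality for a sum forces equality for every summand. This makes the
  property stable under positive combinations.\<close>

definition segment_rigid :: "('a::real_vector \<Rightarrow> real) \<Rightarrow> bool" where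
  "segment_rigid f \<longleftrightarrow> convex_on UNIV f \<and>
    (\<forall>a b. f ((1/2) *\<^sub>R a + (1/2) *\<^sub>R b) = (f a + f b) / 2 \<longrightarrow>
      (\<forall>t. f ((1 - t) *\<^sub>R a + t *\<^sub>R b) = f a))"

lemma segment_rigid_midpoint_le:
  assumes "segment_rigid f"
  shows "f ((1/2) *\<^sub>R a + (1/2) *\<^sub>R b) \<le> (f a + f b) / 2"
proof -
  have "convex_on UNIV f"
    using assms by (simp add: segment_rigid_def)
  from convex_onD[OF this, of "1/2" a b] show ?thesis
    by (simp add: field_simps)
qed

lemma segment_rigid_cmult:
  assumes "segment_rigid f" "c > 0"
  shows "segment_rigid (\<lambda>x. c * f x)"
proof -
  have "f ((1/2) *\<^sub>R a + (1/2) *\<^sub>R b) = (f a + f b) / 2"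
    if "c * f ((1/2) *\<^sub>R a + (1/2) *\<^sub>R b) = (c * f a + c * f b) / 2" for a b
  proof -
    have "c * f ((1/2) *\<^sub>R a + (1/2) *\<^sub>R b) = c * ((f a + f b) / 2)"
      using that by (simp add: field_simps)
    then show ?thesis
      using \<open>c > 0\<close> by simp
  qed
  then show ?thesis
    using assms unfolding segment_rigid_def by (auto intro: convex_on_cmul)
qed

lemma segment_rigid_sum:
  fixes f :: "'i \<Rightarrow> 'a::real_vector \<Rightarrow> real"
  assumes "finite I" "\<And>i. i \<in> I \<Longrightarrow> segment_rigid (f i)"
  shows "segment_rigid (\<lambda>x. \<Sum>i\<in>I. f i x)"
  using assms
proof (induction rule: finite_induct)
  case empty
  then show ?case
    by (simp add: segment_rigid_def convex_on_const)
next
  case (insert i I)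
  let ?F = "\<lambda>x. \<Sum>i\<in>I. f i x"
  have rig: "segment_rigid (f i)" "segment_rigid ?F"
    using insert by auto
  show ?case
    unfolding sum.insert[OF insert(1,2)] segment_rigid_def
  proof (intro conjI allI impI)
    show "convex_on UNIV (\<lambda>x. f i x + ?F x)"
      using rig by (auto simp: segment_rigid_def intro: convex_on_add)
  next
    fix a b :: 'a and t :: real
    let ?m = "(1/2) *\<^sub>R a + (1/2) *\<^sub>R b"
    assume "f i ?m + ?F ?m = (f i a + ?F a + (f i b + ?F b)) / 2"
    with segment_rigid_midpoint_le[OF rig(1), of a b] segment_rigid_midpoint_le[OF rig(2), of a b]
    have "f i ?m = (f i a + f i b) / 2" "?F ?m = (?F a + ?F b) / 2"
      by argo+
    with rig show "f i ((1 - t) *\<^sub>R a + t *\<^sub>R b) + ?F ((1 - t) *\<^sub>R a + t *\<^sub>R b) = f i a + ?F a"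
      unfolding segment_rigid_def by simp
  qed
qed

text \<open>A linear map commutes with every combination
  \<open>(1 - t) *\<^sub>R a + t *\<^sub>R b\<close>. This transfers rigidity from score vectors to
  classifier parameters.\<close>

lemma segment_rigid_linear:
  assumes "segment_rigid f" "linear L"
  shows "segment_rigid (\<lambda>x. f (L x))"
  using assms
  by (simp add: segment_rigid_def convex_on_def linear_add linear_scale)

section \<open>Log-sum-exp, cross-entropy and the support loss\<close>

lemma convex_combination_exp_le:
  fixes u v t :: real
  assumes "0 \<le> t" "t \<le> 1"
  shows "exp ((1 - t) * u + t * v) \<le> (1 - t) * exp u + t * exp v"
  using convex_onD[OF exp_convex, of t u v] assms by simp

text \<open>This is the equality case of the arithmetic-geometric mean inequality for
  \<open>exp u\<close> and \<open>exp v\<close>: the difference of the two means is half the square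
  of \<open>exp (u/2) - exp (v/2)\<close>.\<close>

lemma exp_midpoint_eqD:
  fixes u v :: real
  assumes "exp ((1/2) * u + (1/2) * v) = (exp u + exp v) / 2"
  shows "u = v"
proof -
  have "exp u = (exp (u/2))\<^sup>2" "exp v = (exp (v/2))\<^sup>2"
    by (simp_all flip: exp_double)
  moreover have "exp ((1/2) * u + (1/2) * v) = exp (u/2) * exp (v/2)"
    by (simp add: mult_exp_exp)
  ultimately have "(exp (u/2) - exp (v/2))\<^sup>2 = 0"
    using assms by (simp add: power2_diff)
  then show ?thesis
    by simp
qed

text \<open>Subtracting the log-partition values \<open>A\<close>, \<open>B\<close> makes the exponentials of both score vectors
  sum to 1; log-convexity is then convexity of \<open>exp\<close> summed over the classes, and equality forces
  the normalized scores to coincide, so that the two score vectors differ by a constant vector.\<close>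

lemma segment_rigid_cross_entropy:
  fixes q :: "'m::finite"
  shows "segment_rigid (\<lambda>s. cross_entropy s q)"
proof -
  define A :: "real^'m \<Rightarrow> real" where "A s = ln (\<Sum>j\<in>UNIV. exp (s $ j))" for s
  have pos: "(\<Sum>j\<in>UNIV. exp (s $ j)) > 0" for s :: "real^'m"
    by (intro sum_pos) auto
  have exp_A: "exp (A s) = (\<Sum>j\<in>UNIV. exp (s $ j))" for s
    using pos by (simp add: A_def)
  have norm1: "(\<Sum>j\<in>UNIV. exp (s $ j - A s)) = 1" for s
    using pos[of s] by (simp add: exp_diff exp_A flip: sum_divide_distrib)
  define e where "e a b t j = (1 - t) * (a $ j - A a) + t * (b $ j - A b)" for a b t j
  \<comment> \<open>The exponent on the left is the gap in the convexity inequality for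
    \<open>A\<close>. The inequality thus says that the sum on the right is at most 1, with equality
    exactly when it is 1.\<close>
  have exp_gap: "exp (A ((1 - t) *\<^sub>R a + t *\<^sub>R b) - ((1 - t) * A a + t * A b)) =
      (\<Sum>j\<in>UNIV. exp (e a b t j))" for a b t
  proof -
    have "e a b t j = ((1 - t) *\<^sub>R a + t *\<^sub>R b) $ j - ((1 - t) * A a + t * A b)" for j
      by (simp add: e_def algebra_simps)
    then show ?thesis
      by (simp add: exp_diff exp_A sum_divide_distrib)
  qed
  have avg: "(\<Sum>j\<in>UNIV. (1 - t) * exp (a $ j - A a) + t * exp (b $ j - A b)) = 1" for a b t
    by (simp add: sum.distrib norm1 flip: sum_distrib_left)
  have le: "exp (e a b t j) \<le> (1 - t) * exp (a $ j - A a) + t * exp (b $ j - A b)"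
    if "0 \<le> t" "t \<le> 1" for a b t j
    unfolding e_def using that by (rule convex_combination_exp_le)
  have conv: "A ((1 - t) *\<^sub>R a + t *\<^sub>R b) \<le> (1 - t) * A a + t * A b" if "0 \<le> t" "t \<le> 1" for a b t
  proof -
    have "exp (A ((1 - t) *\<^sub>R a + t *\<^sub>R b) - ((1 - t) * A a + t * A b)) \<le>
        (\<Sum>j\<in>UNIV. (1 - t) * exp (a $ j - A a) + t * exp (b $ j - A b))"
      unfolding exp_gap using le that by (intro sum_mono) auto
    also have "\<dots> = 1"
      by (rule avg)
    finally have "exp (A ((1 - t) *\<^sub>R a + t *\<^sub>R b) - ((1 - t) * A a + t * A b)) \<le> 1" .
    then show ?thesis
      by simp
  qed
  \<comment> \<open>Log-sum-exp is affine with slope 1 in the direction of a constant vector; these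
    are the only directions that equality will leave.\<close>
  have A_shift: "A (s + t *\<^sub>R (\<chi> j. c)) = A s + t * c" for s t c
  proof -
    have "exp (A (s + t *\<^sub>R (\<chi> j. c))) = exp (A s + t * c)"
      by (simp add: exp_A exp_add flip: sum_distrib_right)
    then show ?thesis
      by simp
  qed
  have ce: "cross_entropy s q = A s - s $ q" for s
    by (simp add: cross_entropy_def A_def)
  show ?thesis
    unfolding segment_rigid_def ce
  proof (intro conjI allI impI)
    show "convex_on UNIV (\<lambda>s. A s - s $ q)"
    proof (rule convex_onI)
      fix t :: real and a b :: "real^'m"
      assume "0 < t" "t < 1"
      then show "A ((1 - t) *\<^sub>R a + t *\<^sub>R b) - ((1 - t) *\<^sub>R a + t *\<^sub>R b) $ q
          \<le> (1 - t) * (A a - a $ q) + t * (A b - b $ q)"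
        using conv[of t a b] by (simp add: algebra_simps)
    qed simp
  next
    fix a b :: "real^'m" and t :: real
    let ?m = "(1/2) *\<^sub>R a + (1/2) *\<^sub>R b"
    assume "A ?m - ?m $ q = (A a - a $ q + (A b - b $ q)) / 2"
    then have "A ?m = (A a + A b) / 2"
      by (simp add: field_simps)
    then have "(\<Sum>j\<in>UNIV. exp (e a b (1/2) j)) = 1"
      using exp_gap[of "1/2" a b] by (simp add: field_simps)
    \<comment> \<open>Both sides of the classwise bounds \<open>le\<close> sum to 1 at
      \<open>t = 1/2\<close>, so every one of these bounds is an equality.\<close>
    then have "(\<Sum>j\<in>UNIV. ((1 - 1/2) * exp (a $ j - A a) + 1/2 * exp (b $ j - A b))
        - exp (e a b (1/2) j)) = 0"
      by (simp only: sum_subtractf avg)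
    then have "\<forall>j. ((1 - 1/2) * exp (a $ j - A a) + 1/2 * exp (b $ j - A b)) - exp (e a b (1/2) j) = 0"
      using le[of "1/2" a b] by (subst (asm) sum_nonneg_eq_0_iff) simp_all
    then have mid: "exp (e a b (1/2) j) = (exp (a $ j - A a) + exp (b $ j - A b)) / 2" for j
      by (simp add: add_divide_distrib)
    define c where "c = A b - A a"
    have "b $ j = a $ j + c" for j
    proof -
      have "exp ((1/2) * (a $ j - A a) + (1/2) * (b $ j - A b)) = (exp (a $ j - A a) + exp (b $ j - A b)) / 2"
        using mid[of j] unfolding e_def by simp
      from exp_midpoint_eqD[OF this] show ?thesis
        by (simp add: c_def)
    qed
    then have "(1 - t) *\<^sub>R a + t *\<^sub>R b = a + t *\<^sub>R (\<chi> j. c)"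
      by (simp add: vec_eq_iff algebra_simps)
    \<comment> \<open>The shift adds \<open>t * c\<close> to the log-partition value and also to the
      score of \<open>q\<close>, so it cancels in the cross-entropy.\<close>
    then show "A ((1 - t) *\<^sub>R a + t *\<^sub>R b) - ((1 - t) *\<^sub>R a + t *\<^sub>R b) $ q = A a - a $ q"
      by (simp add: A_shift)
  qed
qed

text \<open>The features do not depend on the classifiers, so each score vector is linear in the
  pair of weight matrix and bias. Nonempty support sets make the weights
  \<open>1 / real (length (S i))\<close> positive.\<close>

lemma segment_rigid_support_loss:
  fixes S :: "'t::finite \<Rightarrow> ('u \<times> 'm::finite) list"
    and F :: "'a \<Rightarrow> ('u \<times> 'm) list \<Rightarrow> 'u \<Rightarrow> real^'p::finite"
  assumes "\<And>i. S i \<noteq> []"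
  shows "segment_rigid (support_loss F S x)"
proof -
  have "linear (\<lambda>y :: ('p, 'm, 't) classifiers. fst (y $ i) *v f + snd (y $ i))" for i f
    by (rule linearI)
      (simp_all add: matrix_vector_mult_add_rdistrib scaleR_right_distrib flip: scaleR_matrix_vector_assoc)
  note term_rigid = segment_rigid_linear[OF segment_rigid_cross_entropy this]
  show ?thesis
    unfolding support_loss_def[abs_def]
    by (intro segment_rigid_cmult segment_rigid_sum term_rigid) (simp_all add: assms)
qed

section \<open>Differentiating an infimum over a compact set\<close>

lemma INF_eq_minimum:
  fixes f :: "'a \<Rightarrow> real"
  assumes "z \<in> K" "\<And>z'. z' \<in> K \<Longrightarrow> f z \<le> f z'"
  shows "(INF z\<in>K. f z) = f z"
  using assms by (intro cInf_eq_minimum) auto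

text \<open>Danskin's theorem for a unique minimizer. For \<open>v\<close> near \<open>w\<close> the
  minimizers lie near \<open>z0\<close>, where the functions being minimized all have nearly the
  same linearization in \<open>v\<close>; the increment of the infimum is squeezed between two of
  their increments.\<close>

lemma danskin:
  fixes \<phi> :: "'a::real_inner \<Rightarrow> 'b::metric_space \<Rightarrow> real"
  assumes K: "compact K" and U: "open U" "w \<in> U"
    and cont: "continuous_on (U \<times> K) (\<lambda>(v, z). \<phi> v z)"
    and der: "\<And>v z. v \<in> U \<Longrightarrow> z \<in> K \<Longrightarrow> GDERIV (\<lambda>v. \<phi> v z) v :> G v z"
    and contG: "continuous_on (U \<times> K) (\<lambda>(v, z). G v z)"
    and z0: "z0 \<in> K"
    and uniq: "\<And>z. z \<in> K \<Longrightarrow> z \<noteq> z0 \<Longrightarrow> \<phi> w z0 < \<phi> w z"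
  shows "GDERIV (\<lambda>v. INF z\<in>K. \<phi> v z) w :> G w z0"
proof -
  define M where "M v = (INF z\<in>K. \<phi> v z)" for v
  have cont_slice: "continuous_on K (\<phi> v)" if "v \<in> U" for v
  proof -
    have "continuous_on K (\<lambda>z. (v, z))"
      by (intro continuous_intros)
    then show ?thesis
      using continuous_on_compose2[OF cont, of K "\<lambda>z. (v, z)"] that by auto
  qed
  have near: "\<exists>d>0. ball w d \<subseteq> U \<and>
      (\<forall>v\<in>ball w d. \<forall>z\<in>K. \<eta> \<le> dist z z0 \<longrightarrow> \<phi> v z0 < \<phi> v z)" if "\<eta> > 0" for \<eta>
  proof -
    define K' where "K' = K \<inter> {z. \<eta> \<le> dist z z0}"
    have "closed {z. \<eta> \<le> dist z z0}"
      by (intro closed_Collect_le continuous_intros)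
    then have "compact K'"
      unfolding K'_def using K by (rule compact_Int_closed[rotated])
    \<comment> \<open>If no point of \<open>K\<close> is as far as \<eta> from \<open>z0\<close>,
      any positive gap will do; otherwise compactness of \<open>K'\<close> makes the least gap
      attained, hence positive.\<close>
    obtain \<gamma> where \<gamma>: "\<gamma> > 0" "\<And>z. z \<in> K' \<Longrightarrow> \<phi> w z0 + \<gamma> \<le> \<phi> w z"
    proof (cases "K' = {}")
      case True
      then show ?thesis
        using that[of 1] by auto
    next
      case False
      have "continuous_on K' (\<phi> w)"
        using cont_slice[OF U(2)] by (rule continuous_on_subset) (auto simp: K'_def)
      then obtain z1 where z1: "z1 \<in> K'" "\<forall>z\<in>K'. \<phi> w z1 \<le> \<phi> w z"
        using continuous_attains_inf[OF \<open>compact K'\<close> False] by blast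
      then have "\<phi> w z0 < \<phi> w z1"
        using \<open>\<eta> > 0\<close> by (intro uniq) (auto simp: K'_def)
      then show ?thesis
        using z1 by (intro that[of "\<phi> w z1 - \<phi> w z0"]) auto
    qed
    \<comment> \<open>Moving from \<open>w\<close> to \<open>v\<close> changes each of the two
      compared values by at most \<gamma>/3, uniformly on \<open>K\<close>, so a third of the gap
      survives.\<close>
    have "\<gamma> / 3 > 0"
      using \<gamma> by simp
    obtain X0 where X0: "w \<in> X0" "open X0"
      "\<forall>v\<in>X0 \<inter> U. \<forall>z\<in>K. dist ((\<lambda>(v, z). \<phi> v z) (v, z)) ((\<lambda>(v, z). \<phi> v z) (w, z)) \<le> \<gamma> / 3"
      using continuous_on_prod_compactE[OF cont K U(2) \<open>\<gamma> / 3 > 0\<close>] by blast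
    obtain d where d: "d > 0" "ball w d \<subseteq> X0 \<inter> U"
      using X0 U open_contains_ball[of "X0 \<inter> U"] by blast
    have "\<phi> v z0 < \<phi> v z" if "v \<in> ball w d" "z \<in> K" "\<eta> \<le> dist z z0" for v z
    proof -
      have "v \<in> X0 \<inter> U"
        using d that by blast
      then have "\<bar>\<phi> v z - \<phi> w z\<bar> \<le> \<gamma> / 3" "\<bar>\<phi> v z0 - \<phi> w z0\<bar> \<le> \<gamma> / 3"
        using X0(3) \<open>v \<in> X0 \<inter> U\<close> that(2) z0 unfolding dist_real_def by auto
      moreover have "\<phi> w z0 + \<gamma> \<le> \<phi> w z"
        using that by (intro \<gamma>) (auto simp: K'_def)
      ultimately show ?thesis
        using \<open>\<gamma> > 0\<close> by argo
    qed
    then show ?thesis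
      using d by blast
  qed
  have M_eq: "M v = \<phi> v z" if "z \<in> K" "\<And>z'. z' \<in> K \<Longrightarrow> \<phi> v z \<le> \<phi> v z'" for v z
    unfolding M_def using that by (rule INF_eq_minimum)
  have min_w: "\<phi> w z0 \<le> \<phi> w z" if "z \<in> K" for z
    using uniq[OF that] by (cases "z = z0") auto
  with z0 have M_w: "M w = \<phi> w z0"
    by (rule M_eq)
  have "\<exists>d>0. \<forall>v. norm (v - w) < d \<longrightarrow>
      norm (M v - M w - inner (v - w) (G w z0)) \<le> \<epsilon> * norm (v - w)" if "\<epsilon> > 0" for \<epsilon>
  proof -
    obtain \<eta> where \<eta>: "\<eta> > 0" "\<And>v z. v \<in> U \<Longrightarrow> z \<in> K \<Longrightarrow> dist (v, z) (w, z0) < \<eta> \<Longrightarrow>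
        dist (G v z) (G w z0) \<le> \<epsilon>"
    proof -
      have "(w, z0) \<in> U \<times> K"
        using U z0 by simp
      then obtain \<eta> where \<eta>: "\<eta> > 0" "\<forall>p\<in>U \<times> K. dist p (w, z0) < \<eta> \<longrightarrow>
          dist ((\<lambda>(v, z). G v z) p) ((\<lambda>(v, z). G v z) (w, z0)) < \<epsilon>"
        using contG \<open>\<epsilon> > 0\<close> unfolding continuous_on_iff by blast
      have "dist (G v z) (G w z0) \<le> \<epsilon>" if "v \<in> U" "z \<in> K" "dist (v, z) (w, z0) < \<eta>" for v z
        using bspec[OF \<eta>(2), of "(v, z)"] that by simp
      with \<eta>(1) show ?thesis
        by (rule that)
    qed
    obtain d where d: "d > 0" "ball w d \<subseteq> U"
      "\<And>v z. v \<in> ball w d \<Longrightarrow> z \<in> K \<Longrightarrow> \<eta> / 2 \<le> dist z z0 \<Longrightarrow> \<phi> v z0 < \<phi> v z"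
      using near[of "\<eta> / 2"] half_gt_zero[OF \<eta>(1)] by blast
    \<comment> \<open>Radius \<open>d\<close> keeps minimizers within \<eta>/2 of \<open>z0\<close>;
      the bound \<eta>/2 on the parameter then keeps the pairs within \<eta> of
      \<open>(w, z0)\<close>.\<close>
    define r where "r = min d (\<eta> / 2)"
    have r: "r > 0" "ball w r \<subseteq> U" "ball w r \<subseteq> ball w d"
      using d \<eta> by (auto simp: r_def)
    have incr: "\<bar>\<phi> v z - \<phi> w z - inner (v - w) (G w z0)\<bar> \<le> \<epsilon> * norm (v - w)"
      if v: "v \<in> ball w r" and z: "z \<in> K" "dist z z0 < \<eta> / 2" for v z
    proof -
      \<comment> \<open>With the expected linear part subtracted, the claim is the mean value
        inequality for a function whose derivative has norm at most \<epsilon>.\<close>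
      let ?f = "\<lambda>v. \<phi> v z - inner v (G w z0)"
      have "norm (?f v - ?f w) \<le> \<epsilon> * norm (v - w)"
      proof (rule differentiable_bound[where S = "ball w r"])
        fix u assume u: "u \<in> ball w r"
        then have "u \<in> U"
          using r by auto
        have "((\<lambda>v. \<phi> v z) has_derivative (\<lambda>h. inner h (G u z))) (at u within ball w r)"
          using der[OF \<open>u \<in> U\<close> z(1)] unfolding gderiv_def by (rule has_derivative_at_withinI)
        then show "(?f has_derivative (\<lambda>h. inner h (G u z) - inner h (G w z0))) (at u within ball w r)"
          by (intro derivative_eq_intros) auto
        have "dist (u, z) (w, z0) < \<eta>"
        proof -
          have "dist (u, z) (w, z0) \<le> dist u w + dist z z0"
            unfolding dist_Pair_Pair using sqrt_sum_squares_le_sum[of "dist u w" "dist z z0"] by simp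
          also have "\<dots> < \<eta> / 2 + \<eta> / 2"
            using u z by (intro add_strict_mono) (auto simp: r_def dist_commute)
          finally show ?thesis
            by simp
        qed
        then have "norm (G u z - G w z0) \<le> \<epsilon>"
          using \<eta>(2)[OF \<open>u \<in> U\<close> z(1)] by (simp add: dist_norm)
        then have "\<bar>inner h (G u z - G w z0)\<bar> \<le> \<epsilon> * norm h" for h
          using Cauchy_Schwarz_ineq2[of h "G u z - G w z0"]
            mult_left_mono[of "norm (G u z - G w z0)" \<epsilon> "norm h"]
          by (simp add: mult.commute)
        then show "onorm (\<lambda>h. inner h (G u z) - inner h (G w z0)) \<le> \<epsilon>"
          using \<open>\<epsilon> > 0\<close> by (intro onorm_bound) (simp_all add: inner_diff_right)
      qed (use v r in auto)
      then show ?thesis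
        by (simp add: inner_diff_left algebra_simps)
    qed
    have "norm (M v - M w - inner (v - w) (G w z0)) \<le> \<epsilon> * norm (v - w)" if "norm (v - w) < r" for v
    proof -
      have v: "v \<in> ball w r" "v \<in> U"
        using that r by (auto simp: dist_norm norm_minus_commute)
      obtain z' where z': "z' \<in> K" "\<forall>z\<in>K. \<phi> v z' \<le> \<phi> v z"
        using continuous_attains_inf[OF K _ cont_slice[OF v(2)]] z0 by blast
      have "dist z' z0 < \<eta> / 2"
        using d(3)[of v z'] z' z0 v r by (meson not_less subsetD)
      then have "\<bar>\<phi> v z' - \<phi> w z' - inner (v - w) (G w z0)\<bar> \<le> \<epsilon> * norm (v - w)"
        by (rule incr[OF v(1) z'(1)])
      moreover have "\<bar>\<phi> v z0 - \<phi> w z0 - inner (v - w) (G w z0)\<bar> \<le> \<epsilon> * norm (v - w)"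
        using \<eta>(1) by (intro incr[OF v(1) z0]) simp
      \<comment> \<open>Testing the infimum at \<open>v\<close> with \<open>z0\<close> bounds
        \<open>M v - M w\<close> above by the increment at \<open>z0\<close>; testing the one at
        \<open>w\<close> with \<open>z'\<close> bounds it below by the increment at
        \<open>z'\<close>.\<close>
      moreover have "M v = \<phi> v z'" "\<phi> v z' \<le> \<phi> v z0" "\<phi> w z0 \<le> \<phi> w z'"
        using M_eq[OF z'(1)] z' z0 min_w by blast+
      ultimately show ?thesis
        unfolding M_w real_norm_def by argo
    qed
    then show ?thesis
      using r by blast
  qed
  then have "(M has_derivative (\<lambda>h. inner h (G w z0))) (at w)"
    unfolding has_derivative_at_alt by (auto intro: bounded_linear_inner_left)
  then show ?thesis
    unfolding gderiv_def M_def[abs_def] .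
qed

text \<open>Riesz representation: the derivative is a linear functional, and its adjoint applied to
  1 is the vector representing it.\<close>

lemma GDERIV_gradient:
  fixes f :: "'a::euclidean_space \<Rightarrow> real"
  assumes "f differentiable (at w)"
  shows "GDERIV f w :> gradient f w"
proof -
  obtain f' where f': "(f has_derivative f') (at w)"
    using assms by (auto simp: differentiable_def)
  then have "f' = (\<lambda>h. inner h (adjoint f' 1))"
    using adjoint_works[of f' _ 1] has_derivative_linear[OF f'] by (auto simp: fun_eq_iff)
  then have "GDERIV f w :> adjoint f' 1"
    using f' by (simp add: gderiv_def)
  then show ?thesis
    using gradient_eqI by metis
qed

section \<open>The proximal objective and first-order convexity inequalities\<close>

text \<open>With \<open>f\<close> the slice of \<open>g\<close> at \<open>x\<close>, the infimum of
  this objective over \<open>Y\<close> is the Moreau envelope at \<open>(x, y)\<close>.\<close>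

definition prox_obj :: "real \<Rightarrow> ('b::real_normed_vector \<Rightarrow> real) \<Rightarrow> 'b \<Rightarrow> 'b \<Rightarrow> real" where
  "prox_obj \<rho> f y z = f z + 1 / (2 * \<rho>) * (norm (z - y))\<^sup>2"

lemma norm_affine_combination_square:
  fixes a b :: "'a::real_inner"
  shows "(norm ((1 - t) *\<^sub>R a + t *\<^sub>R b))\<^sup>2 =
    (1 - t) * (norm a)\<^sup>2 + t * (norm b)\<^sup>2 - t * (1 - t) * (norm (a - b))\<^sup>2"
  by (simp add: power2_norm_eq_inner inner_simps inner_commute algebra_simps)

text \<open>The squared norm is strictly convex, so the objective at the midpoint of
  \<open>z\<close> and \<open>c\<close> lies strictly below the average of its two values, yet not
  below the minimum. This supplies the uniqueness that \<open>danskin\<close> requires.\<close>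

lemma prox_obj_strict_min:
  fixes f :: "'b::real_inner \<Rightarrow> real"
  assumes f: "convex_on Y f" and "\<rho> > 0"
    and z: "z \<in> Y" "\<And>c. c \<in> Y \<Longrightarrow> prox_obj \<rho> f y z \<le> prox_obj \<rho> f y c"
    and c: "c \<in> Y" "c \<noteq> z"
  shows "prox_obj \<rho> f y z < prox_obj \<rho> f y c"
proof -
  define m where "m = (1 - 1/2) *\<^sub>R z + (1/2) *\<^sub>R c"
  have "m \<in> Y"
    unfolding m_def using convex_on_imp_convex[OF f] z c by (intro convexD) auto
  have "m - y = (1 - 1/2) *\<^sub>R (z - y) + (1/2) *\<^sub>R (c - y)"
    by (simp add: m_def algebra_simps flip: scaleR_left_distrib)
  then have "(norm (m - y))\<^sup>2 = (norm (z - y))\<^sup>2 / 2 + (norm (c - y))\<^sup>2 / 2 - (norm (z - c))\<^sup>2 / 4"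
    by (simp only: norm_affine_combination_square) simp
  moreover have "(norm (z - c))\<^sup>2 > 0"
    using c by simp
  ultimately have "(norm (m - y))\<^sup>2 < ((norm (z - y))\<^sup>2 + (norm (c - y))\<^sup>2) / 2"
    by argo
  then have "1 / (2 * \<rho>) * (norm (m - y))\<^sup>2 < 1 / (2 * \<rho>) * (((norm (z - y))\<^sup>2 + (norm (c - y))\<^sup>2) / 2)"
    using \<open>\<rho> > 0\<close> by (intro mult_strict_left_mono) auto
  moreover have "f m \<le> (f z + f c) / 2"
    using convex_onD[OF f, of "1/2" z c] z c by (simp add: m_def)
  ultimately have "prox_obj \<rho> f y m < (prox_obj \<rho> f y z + prox_obj \<rho> f y c) / 2"
    by (simp add: prox_obj_def algebra_simps add_divide_distrib)
  with z(2)[OF \<open>m \<in> Y\<close>] show ?thesis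
    by argo
qed

text \<open>Optimality of \<open>z\<close> makes \<open>(y - z) / \<rho>\<close> a subgradient of
  \<open>f\<close> at \<open>z\<close> relative to \<open>Y\<close>. Minimality is tested at points
  moving from \<open>z\<close> towards \<open>c\<close>, and the first-order terms are
  compared.\<close>

lemma prox_subgradient:
  fixes f :: "'b::real_inner \<Rightarrow> real"
  assumes f: "convex_on Y f" and "\<rho> > 0"
    and z: "z \<in> Y" "\<And>c. c \<in> Y \<Longrightarrow> prox_obj \<rho> f y z \<le> prox_obj \<rho> f y c"
    and c: "c \<in> Y"
  shows "f z + inner (y - z) (c - z) / \<rho> \<le> f c"
proof -
  \<comment> \<open>\<open>N\<close> is the coefficient of \<open>t\<^sup>2\<close> in the quadratic
    penalty along the segment from \<open>z\<close> to \<open>c\<close>.\<close>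
  define N where "N = (norm (c - z))\<^sup>2 / (2 * \<rho>)"
  have step: "inner (y - z) (c - z) / \<rho> - (f c - f z) \<le> t * N" if t: "0 < t" "t < 1" for t
  proof -
    let ?p = "(1 - t) *\<^sub>R z + t *\<^sub>R c"
    have "?p \<in> Y"
      using convex_on_imp_convex[OF f] z c t by (intro convexD) auto
    have p: "?p - y = (z - y) + t *\<^sub>R (c - z)"
      by (simp add: algebra_simps)
    have "(norm (?p - y))\<^sup>2 = (norm (z - y))\<^sup>2 - 2 * t * inner (y - z) (c - z) + t\<^sup>2 * (norm (c - z))\<^sup>2"
      unfolding p power2_norm_eq_inner
      by (simp add: inner_simps inner_commute power2_eq_square algebra_simps)
    then have "1 / (2 * \<rho>) * (norm (?p - y))\<^sup>2 = 1 / (2 * \<rho>) * (norm (z - y))\<^sup>2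
        - t * (inner (y - z) (c - z) / \<rho>) + t\<^sup>2 * N"
      using \<open>\<rho> > 0\<close> by (simp add: N_def field_simps)
    moreover have "f ?p \<le> (1 - t) * f z + t * f c"
      using convex_onD[OF f, of t z c] z c t by simp
    ultimately have "0 \<le> t * (f c - f z) - t * (inner (y - z) (c - z) / \<rho>) + t\<^sup>2 * N"
      using z(2)[OF \<open>?p \<in> Y\<close>] unfolding prox_obj_def by (simp add: algebra_simps)
    then have "t * (inner (y - z) (c - z) / \<rho> - (f c - f z)) \<le> t * (t * N)"
      by (simp add: algebra_simps power2_eq_square)
    then show ?thesis
      using t by simp
  qed
  \<comment> \<open>The left side is free of \<open>t\<close>, so the second-order error is removed
    by letting \<open>t\<close> tend to 0 from the right.\<close>
  have "inner (y - z) (c - z) / \<rho> - (f c - f z) \<le> 0"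
  proof (rule tendsto_lowerbound)
    show "((\<lambda>t. t * N) \<longlongrightarrow> 0) (at_right 0)"
      by (auto intro!: tendsto_eq_intros)
    show "\<forall>\<^sub>F t in at_right 0. inner (y - z) (c - z) / \<rho> - (f c - f z) \<le> t * N"
      unfolding eventually_at_right_field using step by (intro exI[of _ 1]) auto
  qed simp
  then show ?thesis
    by simp
qed

text \<open>Convexity bounds the difference quotients from \<open>y\<close> towards \<open>c\<close>
  by \<open>f c - f y\<close>. Only the right-hand limit is used, since \<open>f\<close> is convex
  on \<open>Y\<close> alone and \<open>y\<close> may lie on its boundary.\<close>

lemma convex_on_derivative_le:
  fixes f :: "'b::real_normed_vector \<Rightarrow> real"
  assumes f: "convex_on Y f" and y: "y \<in> Y" "c \<in> Y" and d: "(f has_derivative f') (at y)"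
  shows "f' (c - y) \<le> f c - f y"
proof -
  have "((\<lambda>t. f (y + t *\<^sub>R (c - y))) has_derivative (\<lambda>t. f' (t *\<^sub>R (c - y)))) (at 0)"
    by (rule has_derivative_compose[where g = f, of "\<lambda>t. y + t *\<^sub>R (c - y)"])
      (auto intro!: derivative_eq_intros d)
  moreover have "(\<lambda>t. f' (t *\<^sub>R (c - y))) = (\<lambda>t. f' (c - y) * t)"
    using linear_scale[OF has_derivative_linear[OF d]] by (auto simp: mult.commute)
  ultimately have "((\<lambda>t. f (y + t *\<^sub>R (c - y))) has_real_derivative f' (c - y)) (at 0)"
    by (simp add: has_field_derivative_def)
  then have "((\<lambda>t. (f (y + t *\<^sub>R (c - y)) - f y) / t) \<longlongrightarrow> f' (c - y)) (at 0)"
    by (simp add: DERIV_def)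
  then have lim: "((\<lambda>t. (f (y + t *\<^sub>R (c - y)) - f y) / t) \<longlongrightarrow> f' (c - y)) (at_right 0)"
    by (rule tendsto_within_subset) simp
  have "(f (y + t *\<^sub>R (c - y)) - f y) / t \<le> f c - f y" if t: "0 < t" "t < 1" for t
  proof -
    have "y + t *\<^sub>R (c - y) = (1 - t) *\<^sub>R y + t *\<^sub>R c"
      by (simp add: algebra_simps)
    then have "f (y + t *\<^sub>R (c - y)) \<le> (1 - t) * f y + t * f c"
      using convex_onD[OF f, of t y c] y t by simp
    then show ?thesis
      using t by (simp add: field_simps)
  qed
  then have "\<forall>\<^sub>F t in at_right 0. (f (y + t *\<^sub>R (c - y)) - f y) / t \<le> f c - f y"
    unfolding eventually_at_right_field by (intro exI[of _ 1]) auto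
  with lim show ?thesis
    by (rule tendsto_upperbound) simp
qed

section \<open>Gradient of the Moreau envelope\<close>

text \<open>By \<open>danskin\<close>, the objective is differentiated in \<open>(x, y)\<close> with
  its minimizer \<open>z\<close> frozen: \<open>x\<close> enters only through \<open>g\<close> and
  \<open>y\<close> only through the penalty.\<close>

lemma GDERIV_moreau_env:
  fixes g :: "'a::euclidean_space \<times> 'b::euclidean_space \<Rightarrow> real"
  assumes Y: "compact Y" and "\<rho> > 0"
    and U: "open U" "{x} \<times> Y \<subseteq> U" "\<And>w. w \<in> U \<Longrightarrow> g differentiable (at w)"
    and contG: "continuous_on U (gradient g)"
    and z: "z \<in> Y"
      "\<And>c. c \<in> Y \<Longrightarrow> c \<noteq> z \<Longrightarrow> prox_obj \<rho> (\<lambda>y. g (x, y)) y z < prox_obj \<rho> (\<lambda>y. g (x, y)) y c"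
  shows "GDERIV (moreau_env Y \<rho> g) (x, y) :> (fst (gradient g (x, z)), (1 / \<rho>) *\<^sub>R (y - z))"
proof -
  define \<phi> where "\<phi> v z = g (fst v, z) + 1 / (2 * \<rho>) * (norm (z - snd v))\<^sup>2" for v :: "'a \<times> 'b" and z
  define G where "G v z = (fst (gradient g (fst v, z)), (1 / \<rho>) *\<^sub>R (snd v - z))" for v :: "'a \<times> 'b" and z
  \<comment> \<open>\<open>danskin\<close> needs one neighbourhood of the parameter that serves all
    of \<open>Y\<close>; compactness of \<open>Y\<close> yields it by the tube lemma. The penalty is
    smooth everywhere, so \<open>y\<close> needs no restriction.\<close>
  obtain X0 where X0: "x \<in> X0" "open X0" "X0 \<times> Y \<subseteq> U"
    using Elementary_Topology.tube_lemma[OF Y U(1,2)] by blast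
  have "GDERIV (\<lambda>v. INF z\<in>Y. \<phi> v z) (x, y) :> G (x, y) z"
  proof (rule danskin[OF Y, where U = "X0 \<times> UNIV"])
    show "open (X0 \<times> (UNIV :: 'b set))" "(x, y) \<in> X0 \<times> UNIV"
      using X0 by (auto intro: open_Times)
    have cont: "continuous_on U g"
      using U by (meson continuous_at_imp_continuous_on differentiable_imp_continuous_within)
    show "continuous_on ((X0 \<times> UNIV) \<times> Y) (\<lambda>(v, z). \<phi> v z)"
      unfolding \<phi>_def case_prod_beta using X0
      by (intro continuous_intros continuous_on_compose2[OF cont]) auto
    show "continuous_on ((X0 \<times> UNIV) \<times> Y) (\<lambda>(v, z). G v z)"
      unfolding G_def case_prod_beta using X0
      by (intro continuous_intros continuous_on_compose2[OF contG]) auto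
    show "z \<in> Y"
      by fact
    show "\<phi> (x, y) z < \<phi> (x, y) c" if "c \<in> Y" "c \<noteq> z" for c
      using z(2)[OF that] by (simp add: \<phi>_def prox_obj_def)
  next
    fix v :: "'a \<times> 'b" and c assume v: "v \<in> X0 \<times> UNIV" "c \<in> Y"
    then have "(fst v, c) \<in> U"
      using X0 by auto
    then have "(g has_derivative (\<lambda>h. inner h (gradient g (fst v, c)))) (at (fst v, c))"
      using GDERIV_gradient[OF U(3)] by (simp add: gderiv_def)
    then have 1: "((\<lambda>v. g (fst v, c)) has_derivative (\<lambda>h. inner (fst h, 0) (gradient g (fst v, c)))) (at v)"
      by (rule has_derivative_compose[rotated]) (auto intro!: derivative_eq_intros)
    have 2: "((\<lambda>v. 1 / (2 * \<rho>) * (norm (c - snd v))\<^sup>2) has_derivative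
        (\<lambda>h. inner (snd h) ((1 / \<rho>) *\<^sub>R (snd v - c)))) (at v)"
      unfolding power2_norm_eq_inner using \<open>\<rho> > 0\<close>
      by (auto intro!: derivative_eq_intros simp: inner_simps inner_commute field_simps)
    show "GDERIV (\<lambda>v. \<phi> v c) v :> G v c"
      unfolding gderiv_def \<phi>_def G_def using has_derivative_add[OF 1 2]
      by (simp add: inner_prod_def)
  qed
  moreover have "moreau_env Y \<rho> g = (\<lambda>v. INF z\<in>Y. \<phi> v z)"
    by (auto simp: moreau_env_def \<phi>_def)
  ultimately show ?thesis
    by (simp add: G_def)
qed

section \<open>From affine segments to the constraint qualification\<close>

text \<open>At a violating point \<open>w = (x, y)\<close> with proximal point \<open>z\<close>, stationarity tested in the
  direction \<open>z - y\<close> bounds \<open>g (x, y) - g (x, z)\<close> above by \<open>\<parallel>y - z\<parallel>\<^sup>2 / \<rho>\<close>; this matches the lower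
  bound from optimality of \<open>z\<close>, so \<open>g (x, \<cdot>)\<close> is affine on the segment from \<open>z\<close> to \<open>y\<close>.\<close>

lemma ENNAMCQ_if_affine_imp_constant:
  fixes g :: "'a::euclidean_space \<times> 'b::euclidean_space \<Rightarrow> real"
  assumes std: "standing_assumptions X Y g \<sigma> \<rho>" and "\<delta> > 0"
    and conv: "\<And>x. x \<in> X \<Longrightarrow> convex_on Y (\<lambda>y. g (x, y))"
    and const: "\<And>x y0 y1 a b. x \<in> X \<Longrightarrow> y0 \<in> Y \<Longrightarrow> y1 \<in> Y \<Longrightarrow>
      (\<And>t. t \<in> {0..1} \<Longrightarrow> g (x, (1 - t) *\<^sub>R y0 + t *\<^sub>R y1) = a + b * t) \<Longrightarrow>
      (\<lambda>t. g (x, (1 - t) *\<^sub>R y0 + t *\<^sub>R y1)) constant_on {0..1}"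
  shows "ENNAMCQ X Y \<rho> \<delta> g"
  unfolding ENNAMCQ_def
proof (intro ballI impI notI)
  fix w assume w: "w \<in> X \<times> Y" and res: "residual Y \<rho> \<delta> g w \<ge> 0"
    and zero: "0 \<in> {gradient (residual Y \<rho> \<delta> g) w + v |v. v \<in> normal_cone (X \<times> Y) w}"
  obtain x y where xy: "w = (x, y)" "x \<in> X" "y \<in> Y"
    using w by auto
  obtain U where U: "open U" "X \<times> Y \<subseteq> U" "\<And>w. w \<in> U \<Longrightarrow> g differentiable (at w)"
      "continuous_on U (gradient g)"
    and Y: "compact Y" "Y \<noteq> {}" "\<rho> > 0"
    using std by (auto simp: standing_assumptions_def smooth_around_def)
  define f where "f c = g (x, c)" for c
  have f: "convex_on Y f"
    using conv[OF xy(2)] by (simp add: f_def[abs_def])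
  have cont: "continuous_on U g"
    using U by (meson continuous_at_imp_continuous_on differentiable_imp_continuous_within)
  have "continuous_on Y (prox_obj \<rho> f y)"
    unfolding prox_obj_def f_def using U xy
    by (intro continuous_intros continuous_on_compose2[OF cont]) auto
  then obtain z where z: "z \<in> Y" "\<And>c. c \<in> Y \<Longrightarrow> prox_obj \<rho> f y z \<le> prox_obj \<rho> f y c"
    using continuous_attains_inf[OF Y(1,2)] by blast
  have env: "moreau_env Y \<rho> g w = prox_obj \<rho> f y z"
    using INF_eq_minimum[of z Y "prox_obj \<rho> f y"] z
    by (simp add: moreau_env_def prox_obj_def f_def xy)
  \<comment> \<open>\<open>D\<close> is the increment from \<open>z\<close> to \<open>y\<close>
    predicted by the subgradient \<open>(y - z) / \<rho>\<close>.\<close>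
  define D where "D = (norm (y - z))\<^sup>2 / \<rho>"
  have lower: "f z + t * D \<le> f ((1 - t) *\<^sub>R z + t *\<^sub>R y)" if t: "t \<in> {0..1}" for t
  proof -
    have "(1 - t) *\<^sub>R z + t *\<^sub>R y \<in> Y"
      using convex_on_imp_convex[OF f] z xy t by (intro convexD) auto
    from prox_subgradient[OF f Y(3) z this] have
      "f z + inner (y - z) ((1 - t) *\<^sub>R z + t *\<^sub>R y - z) / \<rho> \<le> f ((1 - t) *\<^sub>R z + t *\<^sub>R y)" .
    moreover have "(1 - t) *\<^sub>R z + t *\<^sub>R y - z = t *\<^sub>R (y - z)"
      by (simp add: algebra_simps)
    ultimately show ?thesis
      by (simp add: D_def power2_norm_eq_inner)
  qed
  have upper: "f y - f z \<le> D"
  proof -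
    have gw: "GDERIV g w :> gradient g w"
      using U xy by (intro GDERIV_gradient) auto
    let ?E = "(fst (gradient g (x, z)), (1 / \<rho>) *\<^sub>R (y - z))"
    have "GDERIV (moreau_env Y \<rho> g) w :> ?E"
      unfolding xy
    proof (rule GDERIV_moreau_env[OF Y(1,3) U(1) _ U(3,4) z(1)])
      show "{x} \<times> Y \<subseteq> U"
        using U xy by auto
      show "prox_obj \<rho> (\<lambda>y. g (x, y)) y z < prox_obj \<rho> (\<lambda>y. g (x, y)) y c" if "c \<in> Y" "c \<noteq> z" for c
        using prox_obj_strict_min[OF f Y(3) z that] by (simp add: f_def[abs_def])
    qed
    then have "GDERIV (residual Y \<rho> \<delta> g) w :> gradient g w - ?E - 0"
      unfolding residual_def[abs_def] by (intro GDERIV_diff gw GDERIV_const)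
    then have grad: "gradient (residual Y \<rho> \<delta> g) w = gradient g w - ?E"
      using gradient_eqI by force
    have "- gradient (residual Y \<rho> \<delta> g) w \<in> normal_cone (X \<times> Y) w"
      using zero by (auto simp: add_eq_0_iff)
    \<comment> \<open>The direction \<open>(x, z) - w\<close> has zero first component, so only the
      \<open>y\<close>-part of the gradient survives.\<close>
    then have "inner (- gradient (residual Y \<rho> \<delta> g) w) ((x, z) - w) \<le> 0"
      using w xy z by (auto simp: normal_cone_def)
    then have "inner ((1 / \<rho>) *\<^sub>R (y - z)) (z - y) \<le> inner (snd (gradient g w)) (z - y)"
      unfolding grad by (simp add: xy inner_prod_def inner_diff_left)
    moreover have "inner ((1 / \<rho>) *\<^sub>R (y - z)) (z - y) = - D"
      using inner_minus_right[of "y - z" "y - z"] by (simp add: D_def power2_norm_eq_inner)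
    ultimately have "- D \<le> inner (snd (gradient g w)) (z - y)"
      by simp
    also have "\<dots> \<le> f z - f y"
    proof -
      have "(f has_derivative (\<lambda>h. inner (0, h) (gradient g w))) (at y)"
        unfolding f_def[abs_def] using gw unfolding gderiv_def xy
        by (rule has_derivative_compose[rotated]) (auto intro!: derivative_eq_intros)
      from convex_on_derivative_le[OF f xy(3) z(1) this] show ?thesis
        by (simp add: inner_prod_def inner_commute)
    qed
    finally show ?thesis
      by simp
  qed
  have aff: "g (x, (1 - t) *\<^sub>R z + t *\<^sub>R y) = f z + D * t" if t: "t \<in> {0..1}" for t
  proof -
    have "f ((1 - t) *\<^sub>R z + t *\<^sub>R y) \<le> (1 - t) * f z + t * f y"
      using convex_onD[OF f, of t z y] t z xy by simp
    also have "\<dots> \<le> f z + t * D"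
      using mult_left_mono[OF upper, of t] t by (simp add: algebra_simps)
    finally show ?thesis
      using lower[OF t] by (simp add: f_def mult.commute)
  qed
  have "(\<lambda>t. g (x, (1 - t) *\<^sub>R z + t *\<^sub>R y)) constant_on {0..1}"
    by (rule const[OF xy(2) z(1) xy(3) aff])
  then obtain k where k: "\<forall>t\<in>{0..1}. g (x, (1 - t) *\<^sub>R z + t *\<^sub>R y) = k"
    by (auto simp: constant_on_def)
  \<comment> \<open>The values at the ends are \<open>f z\<close> and \<open>f z + D\<close>, so
    constancy forces the slope to vanish.\<close>
  have "D = 0"
    using bspec[OF k, of 0] bspec[OF k, of 1] aff[of 0] aff[of 1] by simp
  then have "y = z"
    using Y by (simp add: D_def)
  \<comment> \<open>At \<open>y = z\<close> the penalty is zero, so the envelope equals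
    \<open>g w\<close>.\<close>
  then have "residual Y \<rho> \<delta> g w = - \<delta>"
    using env by (simp add: residual_def prox_obj_def f_def xy)
  with res \<open>\<delta> > 0\<close> show False
    by simp
qed

text \<open>\<open>g\<close> lives on the whole product space but is tied to the loss only over
  \<open>X\<close> and \<open>Y\<close>, because the standing assumptions speak of differentiability
  on a neighbourhood.\<close>

theorem proposition16:
  fixes X :: "'a::euclidean_space set"
    and Y :: "('p::finite, 'm::finite, 't::finite) classifiers set"
    and S :: "'t \<Rightarrow> ('u \<times> 'm) list"
    and F :: "'a \<Rightarrow> ('u \<times> 'm) list \<Rightarrow> 'u \<Rightarrow> real^'p"
    and g :: "'a \<times> ('p, 'm, 't) classifiers \<Rightarrow> real"
  assumes "\<And>i. S i \<noteq> []"
    and "convex Y"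
    and "\<And>x y. x \<in> X \<Longrightarrow> y \<in> Y \<Longrightarrow> g (x, y) = support_loss F S x y"
  shows "(\<forall>x\<in>X. convex_on Y (\<lambda>y. g (x, y)) \<and>
           (\<forall>y0\<in>Y. \<forall>y1\<in>Y.
             (\<exists>a b. \<forall>t\<in>{0..1}. g (x, (1 - t) *\<^sub>R y0 + t *\<^sub>R y1) = a + b * t) \<longrightarrow>
             (\<lambda>t. g (x, (1 - t) *\<^sub>R y0 + t *\<^sub>R y1)) constant_on {0..1})) \<and>
         (\<forall>\<sigma> \<rho> \<delta>. standing_assumptions X Y g \<sigma> \<rho> \<and> \<delta> > 0 \<longrightarrow> ENNAMCQ X Y \<rho> \<delta> g)"
proof -
  \<comment> \<open>Segments must stay in \<open>Y\<close> for \<open>g\<close> to be replaced by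
    the support loss along them.\<close>
  have seg: "(1 - t) *\<^sub>R y0 + t *\<^sub>R y1 \<in> Y" if "y0 \<in> Y" "y1 \<in> Y" "t \<in> {0..1}" for y0 y1 and t :: real
    using assms(2) that by (intro convexD) auto
  have rig: "segment_rigid (support_loss F S x)" for x
    using assms(1) by (rule segment_rigid_support_loss)
  have conv: "convex_on Y (\<lambda>y. g (x, y))" if x: "x \<in> X" for x
  proof (rule convex_onI)
    fix t :: real and y0 y1
    assume t: "0 < t" "t < 1" and y: "y0 \<in> Y" "y1 \<in> Y"
    have "convex_on UNIV (support_loss F S x)"
      using rig by (simp add: segment_rigid_def)
    from convex_onD[OF this, of t y0 y1] t y seg[OF y, of t]
    show "g (x, (1 - t) *\<^sub>R y0 + t *\<^sub>R y1) \<le> (1 - t) * g (x, y0) + t * g (x, y1)"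
      by (simp add: assms(3)[OF x])
  qed fact
  have const: "(\<lambda>t. g (x, (1 - t) *\<^sub>R y0 + t *\<^sub>R y1)) constant_on {0..1}"
    if x: "x \<in> X" and y: "y0 \<in> Y" "y1 \<in> Y"
      and aff: "\<And>t. t \<in> {0..1} \<Longrightarrow> g (x, (1 - t) *\<^sub>R y0 + t *\<^sub>R y1) = a + b * t"
    for x y0 y1 a b
  proof -
    have sl: "support_loss F S x ((1 - t) *\<^sub>R y0 + t *\<^sub>R y1) = a + b * t" if "t \<in> {0..1}" for t
      using aff[OF that] assms(3)[OF x seg[OF y that]] by simp
    \<comment> \<open>Affineness is read off at 0, 1/2 and 1 only; this is the midpoint equality
      that rigidity takes as its premise.\<close>
    have "support_loss F S x ((1/2) *\<^sub>R y0 + (1/2) *\<^sub>R y1) = (support_loss F S x y0 + support_loss F S x y1) / 2"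
      using sl[of 0] sl[of 1] sl[of "1/2"] by (simp add: field_simps)
    then have "support_loss F S x ((1 - t) *\<^sub>R y0 + t *\<^sub>R y1) = support_loss F S x y0" for t
      using rig unfolding segment_rigid_def by blast
    then show ?thesis
      unfolding constant_on_def using assms(3)[OF x] seg[OF y] by auto
  qed
  have "ENNAMCQ X Y \<rho> \<delta> g" if "standing_assumptions X Y g \<sigma> \<rho>" "\<delta> > 0" for \<sigma> \<rho> \<delta>
    using that conv const by (rule ENNAMCQ_if_affine_imp_constant)
  with conv const show ?thesis
    by blast
qed

end
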